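(* Let $n=\sum_{i=0}^r k_i$ with $k_0\ge0$ and $k_i\ge1$ for $i\ge1$, let $v_0\in\mathbb{H}^{k_0}$ and $v_i\in\mathbb{H}^{k_i}_c\setminus\mathbb{R}^{k_i}$ for $1\le i\le r$, and let $$S=\mathbb{S}(v_0;v_1,\dots,v_r)=\{v_0\}\times\prod_{i=1}^r\mathbb{S}_{v_i}\subseteq\mathbb{H}^n$$ be the corresponding $r$-multisphere. For each $1\le i\le r$, let $w_{i,1}$ and $w_{i,2}$ be two distinct points in $\mathbb{S}_{v_i}$. Consider the set $$Q=\{v_0\}\times\{w_{1,1},w_{1,2}\}\times\cdots\times\{w_{r,1},w_{r,2}\}\subseteq S.$$ If a polynomial $p\in\mathbb{H}[x_1,\dots,x_n]$ vanishes on $Q$, then $p$ vanishes on the entire multisphere $S$.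
   Context: $\mathbb{H}$ is Hamilton's algebra of real quaternions. $\mathbb{H}[x_1,\dots,x_n]$ is the ring of polynomials in $n$ central variables (also called slice regular polynomials): the variables commute with each other and with all coefficients. For $f=\sum a_{i_1,\dots,i_n}x_1^{i_1}\cdots x_n^{i_n}$ (coefficients on the left) and any $a=(a_1,\dots,a_n)\in\mathbb{H}^n$, define $f(a)=\sum a_{i_1,\dots,i_n}a_1^{i_1}\cdots a_n^{i_n}$ (products in this order); $f$ vanishes on a set if $f(a)=0$ for all its points $a$. For $m\ge1$, $\mathbb{H}^m_c=\{(q_1,\dots,q_m)\in\mathbb{H}^m : q_iq_j=q_jq_i\text{ for all }i,j\}$. For $w=(q_1,\dots,q_m)\in\mathbb{H}^m$, $\mathbb{S}_w=\{(qq_1q^{-1},\dots,qq_mq^{-1}) : q\in\mathbb{H}\setminus\{0\}\}$. *)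

theory Defs
  imports Complex_Main "HOL-Library.Poly_Mapping"
begin

datatype quat = Quat (q1: real) (qi: real) (qj: real) (qk: real)

lemma quat_eq_iff: "x = y \<longleftrightarrow> q1 x = q1 y \<and> qi x = qi y \<and> qj x = qj y \<and> qk x = qk y"
  by (cases x; cases y) simp

instantiation quat :: ab_group_add
begin
definition "0 = Quat 0 0 0 0"
definition "x + y = Quat (q1 x + q1 y) (qi x + qi y) (qj x + qj y) (qk x + qk y)"
definition "- x = Quat (- q1 x) (- qi x) (- qj x) (- qk x)"
definition "x - y = Quat (q1 x - q1 y) (qi x - qi y) (qj x - qj y) (qk x - qk y)"
instance
  by standard (simp_all add: zero_quat_def plus_quat_def uminus_quat_def minus_quat_def)
end

lemma quat_add_sel [simp]:
  "q1 0 = 0" "qi 0 = 0" "qj 0 = 0" "qk 0 = 0"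
  "q1 (x + y) = q1 x + q1 y" "qi (x + y) = qi x + qi y"
  "qj (x + y) = qj x + qj y" "qk (x + y) = qk x + qk y"
  "q1 (- x) = - q1 x" "qi (- x) = - qi x" "qj (- x) = - qj x" "qk (- x) = - qk x"
  "q1 (x - y) = q1 x - q1 y" "qi (x - y) = qi x - qi y"
  "qj (x - y) = qj x - qj y" "qk (x - y) = qk x - qk y"
  by (simp_all add: zero_quat_def plus_quat_def uminus_quat_def minus_quat_def)

definition quat_normsq :: "quat \<Rightarrow> real" where
  "quat_normsq x = (q1 x)\<^sup>2 + (qi x)\<^sup>2 + (qj x)\<^sup>2 + (qk x)\<^sup>2"

lemma quat_normsq_eq_0_iff [simp]: "quat_normsq x = 0 \<longleftrightarrow> x = 0"
proof -
  have "quat_normsq x = 0 \<longleftrightarrow> q1 x = 0 \<and> qi x = 0 \<and> qj x = 0 \<and> qk x = 0"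
    unfolding quat_normsq_def
    by (auto simp: add_nonneg_eq_0_iff)
  then show ?thesis by (simp add: quat_eq_iff)
qed

instantiation quat :: real_div_algebra
begin
definition "1 = Quat 1 0 0 0"
definition "x * y = Quat
  (q1 x * q1 y - qi x * qi y - qj x * qj y - qk x * qk y)
  (q1 x * qi y + qi x * q1 y + qj x * qk y - qk x * qj y)
  (q1 x * qj y - qi x * qk y + qj x * q1 y + qk x * qi y)
  (q1 x * qk y + qi x * qj y - qj x * qi y + qk x * q1 y)"
definition "r *\<^sub>R x = Quat (r * q1 x) (r * qi x) (r * qj x) (r * qk x)"
definition "inverse x = (1 / quat_normsq x) *\<^sub>R Quat (q1 x) (- qi x) (- qj x) (- qk x)"
definition "x div y = x * inverse (y :: quat)"
instance
proof
  fix x :: quat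
  assume "x \<noteq> 0"
  then have n: "quat_normsq x \<noteq> 0" by simp
  show "inverse x * x = 1" "x * inverse x = 1"
    using n by (simp_all add: inverse_quat_def times_quat_def one_quat_def scaleR_quat_def
        quat_eq_iff field_simps) (simp_all add: quat_normsq_def power2_eq_square)
qed (simp_all add: quat_eq_iff times_quat_def one_quat_def scaleR_quat_def inverse_quat_def
      divide_quat_def algebra_simps)
end

lemma quat_units_mult:
  defines "i \<equiv> Quat 0 1 0 0" and "j \<equiv> Quat 0 0 1 0" and "k \<equiv> Quat 0 0 0 1"
  shows "i * i = - 1" "j * j = - 1" "k * k = - 1" "i * j = k" "j * k = i" "k * i = j"
    "i * j * k = - 1"
  by (simp_all add: i_def j_def k_def times_quat_def one_quat_def uminus_quat_def)

lemma quat_of_real: "of_real r = Quat r 0 0 0"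
  by (simp add: of_real_def one_quat_def scaleR_quat_def)

text \<open>
  The convolution product of \<open>(nat \<Rightarrow>\<^sub>0 nat) \<Rightarrow>\<^sub>0 quat\<close> lets the variables commute with
  each other and with the coefficients. The variables are numbered from \<open>0\<close>, as are the
  entries of the lists that represent points, so the variable written \<open>x\<^sub>1\<close> on paper has
  index \<open>0\<close>.
\<close>

type_synonym qpoly = "(nat \<Rightarrow>\<^sub>0 nat) \<Rightarrow>\<^sub>0 quat"

definition qpolys :: "nat \<Rightarrow> qpoly set" where
  "qpolys n = {p. \<forall>m \<in> Poly_Mapping.keys p. Poly_Mapping.keys m \<subseteq> {..<n}}"

text \<open>
  Quaternions do not commute, so the powers are multiplied as a list product, in increasing
  order of the variables and to the right of the coefficient. The value is the intended
  one when \<open>p \<in> qpolys (length a)\<close>.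
\<close>

definition qeval :: "qpoly \<Rightarrow> quat list \<Rightarrow> quat" where
  "qeval p a = (\<Sum>m \<in> Poly_Mapping.keys p.
     Poly_Mapping.lookup p m * (\<Prod>i \<leftarrow> [0..<length a]. (a ! i) ^ Poly_Mapping.lookup m i))"

definition vanishes_on :: "qpoly \<Rightarrow> quat list set \<Rightarrow> bool" where
  "vanishes_on p A \<longleftrightarrow> (\<forall>a \<in> A. qeval p a = 0)"

definition commuting_tuples :: "nat \<Rightarrow> quat list set" where
  "commuting_tuples m = {w. length w = m \<and> (\<forall>x \<in> set w. \<forall>y \<in> set w. x * y = y * x)}"

definition real_tuples :: "nat \<Rightarrow> quat list set" where
  "real_tuples m = {w. length w = m \<and> set w \<subseteq> \<real>}"

definition qsphere :: "quat list \<Rightarrow> quat list set" where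
  "qsphere w = {map (\<lambda>x. q * x * inverse q) w | q. q \<noteq> 0}"

text \<open>
  The product \<open>A\<^sub>0 \<times> \<dots> \<times> A\<^sub>r\<close> of sets of tuples, where a tuple of tuples is identified with
  the concatenated tuple.
\<close>

definition block_product :: "quat list set list \<Rightarrow> quat list set" where
  "block_product As = concat ` listset As"

definition multisphere :: "quat list \<Rightarrow> quat list list \<Rightarrow> quat list set" where
  "multisphere v0 vs = block_product ({v0} # map qsphere vs)"

end

theory Submission
  imports Defs
begin

text \<open>
  The entries of a commuting tuple \<open>v\<close> with a non-real entry \<open>x\<close> lie in the centralizer of
  \<open>x\<close>, which is the plane \<open>\<real> + \<real>x\<close>; so does every monomial in these entries. Conjugation is
  an algebra automorphism that fixes the reals. Hence a monomial has at the conjugate \<open>u\<close> of \<open>v\<close>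
  a value \<open>A + B J u\<close>, where \<open>J u\<close> is the entry of \<open>u\<close> in the place of \<open>x\<close> and the real numbers \<open>A\<close> and \<open>B\<close>
  depend on the monomial but not on \<open>u\<close>. Moreover \<open>J u\<close> determines \<open>u\<close>
  (\<open>monomials_affine_on_qsphere\<close>).

  Consider now the last block of a multisphere. Because \<open>A\<close> and \<open>B\<close> are central, they can be
  absorbed into the coefficients of the polynomial \<open>p\<close>, and so
  \<open>p(a, u) = f(a) + g(a) J u\<close> for polynomials \<open>f\<close> and \<open>g\<close> in the earlier variables. The last
  block stands at the right end of every product; therefore vanishing at two points \<open>w\<close> and
  \<open>w'\<close> gives \<open>g(a) (J w - J w') = 0\<close>, so that \<open>g(a) = 0\<close> and then \<open>f(a) = 0\<close>. Thus \<open>f\<close> and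
  \<open>g\<close> vanish at all grid points \<open>a\<close> of the product of the earlier blocks, and by induction on the
  number of blocks they vanish on the whole product of those blocks
  (\<open>determines_append_qsphere\<close>).
\<close>

definition determines :: "quat list set \<Rightarrow> quat list set \<Rightarrow> bool" where
  "determines Q S \<longleftrightarrow> (\<forall>p. vanishes_on p Q \<longrightarrow> vanishes_on p S)"

definition monom_at :: "(nat \<Rightarrow> nat) \<Rightarrow> quat list \<Rightarrow> quat" where
  "monom_at e a = (\<Prod>i \<leftarrow> [0..<length a]. (a ! i) ^ e i)"

lemma qeval_eq_sum_monom_at:
  "qeval p a = (\<Sum>m \<in> Poly_Mapping.keys p.
     Poly_Mapping.lookup p m * monom_at (Poly_Mapping.lookup m) a)"
  by (simp add: qeval_def monom_at_def)

lemma monom_at_append: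
  "monom_at e (a @ u) = monom_at e a * monom_at (\<lambda>i. e (i + length a)) u"
proof -
  have "[0..<length (a @ u)] = [0..<length a] @ map (\<lambda>i. i + length a) [0..<length u]"
    by (simp add: map_add_upt upt_add_eq_append[of 0, simplified] add.commute)
  moreover have "map (\<lambda>i. ((a @ u) ! i) ^ e i) [0..<length a]
      = map (\<lambda>i. (a ! i) ^ e i) [0..<length a]"
    by (simp add: nth_append)
  moreover have "(a @ u) ! (i + length a) = u ! i" for i
    by (simp add: nth_append)
  ultimately show ?thesis
    unfolding monom_at_def by (simp only: map_append prod_list.append map_map o_def)
qed

lemma commutes_monom_at:
  assumes "\<And>y. y \<in> set a \<Longrightarrow> x * y = y * x"
  shows "x * monom_at e a = monom_at e a * x"
proof -
  have "x * (\<Prod>i\<leftarrow>is. (a ! i) ^ e i) = (\<Prod>i\<leftarrow>is. (a ! i) ^ e i) * x"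
    if "set is \<subseteq> {..<length a}" for "is"
    using that
  proof (induction "is")
    case (Cons i "is")
    then have "x * (a ! i) ^ e i = (a ! i) ^ e i * x"
      using assms[of "a ! i"] by (simp add: power_commuting_commutes)
    then show ?case
      using Cons by (simp, metis mult.assoc)
  qed simp
  then show ?thesis
    by (simp add: monom_at_def atLeast0LessThan)
qed

lemma conjugate_power:
  fixes q :: quat
  assumes "q \<noteq> 0"
  shows "(q * x * inverse q) ^ n = q * x ^ n * inverse q"
proof (induction n)
  case (Suc n)
  have "(q * x * inverse q) ^ Suc n = q * x * (inverse q * q) * x ^ n * inverse q"
    using Suc by (simp add: mult.assoc)
  then show ?case
    using assms by (simp add: mult.assoc)
qed (use assms in simp)

lemma monom_at_conjugate:
  assumes "q \<noteq> 0"
  shows "monom_at e (map (\<lambda>x. q * x * inverse q) a) = q * monom_at e a * inverse q"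
proof -
  have "(\<Prod>i\<leftarrow>is. (map (\<lambda>x. q * x * inverse q) a ! i) ^ e i)
      = q * (\<Prod>i\<leftarrow>is. (a ! i) ^ e i) * inverse q"
    if "set is \<subseteq> {..<length a}" for "is"
    using that
  proof (induction "is")
    case (Cons i "is")
    let ?P = "\<Prod>i\<leftarrow>is. (a ! i) ^ e i"
    have "(\<Prod>i\<leftarrow>i # is. (map (\<lambda>x. q * x * inverse q) a ! i) ^ e i)
        = (q * (a ! i) ^ e i * inverse q) * (q * ?P * inverse q)"
      using Cons assms by (simp add: conjugate_power)
    also have "\<dots> = q * (a ! i) ^ e i * (inverse q * q) * ?P * inverse q"
      by (simp add: mult.assoc)
    finally show ?case
      using assms by (simp add: mult.assoc)
  qed (use assms in simp)
  then show ?thesis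
    by (simp add: monom_at_def atLeast0LessThan)
qed

text \<open>
  The product of two quaternions is symmetric up to the cross product of their imaginary parts.
  So these parts are parallel when the quaternions commute.
\<close>

lemma quat_centralizer:
  fixes x y :: quat
  assumes "x \<notin> \<real>" and "x * y = y * x"
  obtains a b :: real where "y = of_real a + of_real b * x"
proof -
  have cross: "qj x * qk y = qk x * qj y" "qk x * qi y = qi x * qk y"
    "qi x * qj y = qj x * qi y"
    using assms(2) by (auto simp: quat_eq_iff times_quat_def algebra_simps)
  have "qi x \<noteq> 0 \<or> qj x \<noteq> 0 \<or> qk x \<noteq> 0"
  proof (rule ccontr)
    assume "\<not> ?thesis"
    then have "x = of_real (q1 x)"
      by (simp add: quat_eq_iff quat_of_real)
    then show False
      using assms(1) by (metis Reals_of_real)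
  qed
  then obtain b where "qi y = b * qi x" "qj y = b * qj x" "qk y = b * qk x"
  proof (elim disjE)
    assume "qi x \<noteq> 0"
    then show thesis using cross by (intro that[of "qi y / qi x"]) (auto simp: field_simps)
  next
    assume "qj x \<noteq> 0"
    then show thesis using cross by (intro that[of "qj y / qj x"]) (auto simp: field_simps)
  next
    assume "qk x \<noteq> 0"
    then show thesis using cross by (intro that[of "qk y / qk x"]) (auto simp: field_simps)
  qed
  then have "y = of_real (q1 y - b * q1 x) + of_real b * x"
    by (simp add: quat_eq_iff quat_of_real times_quat_def del: of_real_diff of_real_mult)
  then show thesis by (rule that)
qed

lemma conjugate_affine:
  fixes x y :: quat
  assumes "x \<notin> \<real>" and "x * y = y * x"
  obtains a b :: real
    where "\<And>q. q \<noteq> 0 \<Longrightarrow> q * y * inverse q = of_real a + of_real b * (q * x * inverse q)"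
proof -
  obtain a b :: real where y: "y = of_real a + of_real b * x"
    using quat_centralizer[OF assms] .
  have "q * y * inverse q = of_real a + of_real b * (q * x * inverse q)" if "q \<noteq> 0" for q
    using that by (simp add: y of_real_def algebra_simps)
  then show thesis by (rule that)
qed

text \<open>
  A non-real entry of \<open>v\<close>, conjugated along with \<open>v\<close>, serves as the coordinate \<open>J\<close> on
  \<open>qsphere v\<close>: all other entries are real affine functions of it.
\<close>

lemma monomials_affine_on_qsphere:
  assumes v: "v \<in> commuting_tuples k - real_tuples k"
  obtains J :: "quat list \<Rightarrow> quat" where "inj_on J (qsphere v)"
    and "\<forall>e. \<exists>A B :: real. \<forall>u \<in> qsphere v. monom_at e u = of_real A + of_real B * J u"
proof -
  from v have comm: "x * y = y * x" if "x \<in> set v" "y \<in> set v" for x y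
    using that by (auto simp: commuting_tuples_def)
  from v obtain l where l: "l < length v" "v ! l \<notin> \<real>"
    by (auto simp: commuting_tuples_def real_tuples_def subset_iff) (metis in_set_conv_nth)
  define x where "x = v ! l"
  have x: "x \<notin> \<real>" "x \<in> set v"
    using l by (simp_all add: x_def)
  show thesis
  proof (rule that[of "\<lambda>u. u ! l"])
    show "inj_on (\<lambda>u. u ! l) (qsphere v)"
    proof (rule inj_onI)
      fix u u' assume "u \<in> qsphere v" "u' \<in> qsphere v" and eq: "u ! l = u' ! l"
      then obtain q q' where q: "q \<noteq> 0" "u = map (\<lambda>x. q * x * inverse q) v"
        and q': "q' \<noteq> 0" "u' = map (\<lambda>x. q' * x * inverse q') v"
        by (auto simp: qsphere_def)
      have "q * y * inverse q = q' * y * inverse q'" if "y \<in> set v" for y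
        using conjugate_affine[OF x(1) comm[OF x(2) that]] eq q q' l
        by (metis nth_map x_def)
      then show "u = u'"
        by (simp add: q q')
    qed
  next
    show "\<forall>e. \<exists>A B :: real. \<forall>u \<in> qsphere v. monom_at e u = of_real A + of_real B * u ! l"
    proof
      fix e
      have "x * monom_at e v = monom_at e v * x"
        using comm x(2) by (blast intro: commutes_monom_at)
      then obtain A B :: real where
        "\<And>q. q \<noteq> 0 \<Longrightarrow> q * monom_at e v * inverse q = of_real A + of_real B * (q * x * inverse q)"
        using conjugate_affine[OF x(1)] by blast
      then have "\<forall>u \<in> qsphere v. monom_at e u = of_real A + of_real B * u ! l"
        using l by (auto simp: qsphere_def x_def monom_at_conjugate)
      then show "\<exists>A B :: real. \<forall>u \<in> qsphere v. monom_at e u = of_real A + of_real B * u ! l"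
        by blast
    qed
  qed
qed

text \<open>
  This formula is applied to the coefficients \<open>f\<close> and \<open>g\<close> of the expansion in \<open>J u\<close>. That they
  are again polynomials makes the induction hypothesis apply to them.
\<close>

lemma qeval_mapp_of_real:
  "qeval (Poly_Mapping.mapp (\<lambda>m c. of_real (A m) * c) p) a
    = (\<Sum>m \<in> Poly_Mapping.keys p. of_real (A m) * Poly_Mapping.lookup p m
        * monom_at (Poly_Mapping.lookup m) a)"
  unfolding qeval_eq_sum_monom_at
  by (rule sum.mono_neutral_cong_left)
    (auto simp: lookup_mapp in_keys_iff keys_mapp_subset dest: subsetD[OF keys_mapp_subset])

text \<open>
  The induction step. All points of \<open>S\<close> have the same length, so the exponents that belong to
  the new block are the same for all of them.
\<close>

lemma determines_append_qsphere:
  assumes "determines Q S" and len: "\<And>a. a \<in> Q \<union> S \<Longrightarrow> length a = L"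
    and v: "v \<in> commuting_tuples k - real_tuples k"
    and w: "w \<in> qsphere v" "w' \<in> qsphere v" "w \<noteq> w'"
  shows "determines {a @ u | a u. a \<in> Q \<and> u \<in> {w, w'}} {a @ u | a u. a \<in> S \<and> u \<in> qsphere v}"
  unfolding determines_def
proof (intro allI impI)
  fix p
  assume p: "vanishes_on p {a @ u | a u. a \<in> Q \<and> u \<in> {w, w'}}"
  obtain J where J: "inj_on J (qsphere v)" and
    "\<forall>e. \<exists>A B :: real. \<forall>u \<in> qsphere v. monom_at e u = of_real A + of_real B * J u"
    using monomials_affine_on_qsphere[OF v] .
  then obtain A B :: "(nat \<Rightarrow> nat) \<Rightarrow> real"
    where AB: "\<And>e u. u \<in> qsphere v \<Longrightarrow> monom_at e u = of_real (A e) + of_real (B e) * J u"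
    by metis
  define tail where "tail m = (\<lambda>i. Poly_Mapping.lookup m (i + L))" for m :: "nat \<Rightarrow>\<^sub>0 nat"
  \<comment> \<open>The monomials of \<open>f\<close> and \<open>g\<close> still contain the variables of the new block; evaluation at a
    point of length \<open>L\<close> ignores their exponents.\<close>
  define f where "f = Poly_Mapping.mapp (\<lambda>m c. of_real (A (tail m)) * c) p"
  define g where "g = Poly_Mapping.mapp (\<lambda>m c. of_real (B (tail m)) * c) p"
  have split: "qeval p (a @ u) = qeval f a + qeval g a * J u"
    if a: "a \<in> Q \<union> S" and u: "u \<in> qsphere v" for a u
  proof -
    have "c * monom_at (Poly_Mapping.lookup m) (a @ u)
        = of_real (A (tail m)) * c * monom_at (Poly_Mapping.lookup m) a
          + of_real (B (tail m)) * c * monom_at (Poly_Mapping.lookup m) a * J u" for m c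
      using len[OF a] by (simp add: monom_at_append AB[OF u] tail_def of_real_def algebra_simps)
    then show ?thesis
      by (simp add: qeval_eq_sum_monom_at[of p] f_def g_def qeval_mapp_of_real sum.distrib
          sum_distrib_right)
  qed
  have "qeval f a = 0 \<and> qeval g a = 0" if "a \<in> Q" for a
  proof -
    have "qeval p (a @ w) = 0" "qeval p (a @ w') = 0"
      using p that by (auto simp: vanishes_on_def)
    then have 1: "qeval f a + qeval g a * J w = 0" "qeval f a + qeval g a * J w' = 0"
      using split that w by simp_all
    have "qeval g a * (J w - J w')
        = (qeval f a + qeval g a * J w) - (qeval f a + qeval g a * J w')"
      by (simp add: right_diff_distrib)
    then have "qeval g a * (J w - J w') = 0"
      by (simp add: 1)
    moreover have "J w - J w' \<noteq> 0"
      using inj_onD[OF J, of w w'] w by auto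
    ultimately show ?thesis
      using 1 by simp
  qed
  then have "vanishes_on f S" "vanishes_on g S"
    using assms(1) by (auto simp: determines_def vanishes_on_def)
  then show "vanishes_on p {a @ u | a u. a \<in> S \<and> u \<in> qsphere v}"
    using split by (auto simp: vanishes_on_def)
qed

lemma listset_snoc: "listset (As @ [A]) = {us @ [u] | us u. us \<in> listset As \<and> u \<in> A}"
proof (induction As)
  case Nil
  show ?case by (auto simp: set_Cons_def)
next
  case (Cons C As)
  show ?case
    by (auto simp: Cons set_Cons_def)
qed

lemma block_product_snoc:
  "block_product (As @ [A]) = {a @ u | a u. a \<in> block_product As \<and> u \<in> A}"
proof -
  have "listset (As @ [A]) = (\<lambda>(us, u). us @ [u]) ` (listset As \<times> A)"
    by (auto simp: listset_snoc)
  then have "block_product (As @ [A]) = (\<lambda>(us, u). concat us @ u) ` (listset As \<times> A)"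
    by (simp add: block_product_def image_image case_prod_unfold)
  then show ?thesis
    by (auto simp: block_product_def)
qed

lemma length_in_qsphere: "u \<in> qsphere v \<Longrightarrow> length u = length v"
  by (auto simp: qsphere_def)

lemma determines_multisphere:
  assumes "\<And>i. i \<in> {1..r} \<Longrightarrow> v i \<in> commuting_tuples (k i) - real_tuples (k i)"
    and "\<And>i. i \<in> {1..r} \<Longrightarrow> w i \<in> qsphere (v i)"
    and "\<And>i. i \<in> {1..r} \<Longrightarrow> w' i \<in> qsphere (v i)"
    and "\<And>i. i \<in> {1..r} \<Longrightarrow> w i \<noteq> w' i"
  shows "determines (block_product ({v0} # map (\<lambda>i. {w i, w' i}) [1..<Suc r]))
           (multisphere v0 (map v [1..<Suc r]))"
proof -
  define Q where "Q j = block_product ({v0} # map (\<lambda>i. {w i, w' i}) [1..<Suc j])" for j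
  define S where "S j = multisphere v0 (map v [1..<Suc j])" for j
  have Q_Suc: "Q (Suc j) = {a @ u | a u. a \<in> Q j \<and> u \<in> {w (Suc j), w' (Suc j)}}" for j
    using block_product_snoc[of "{v0} # map (\<lambda>i. {w i, w' i}) [1..<Suc j]"]
    by (simp add: Q_def)
  have S_Suc: "S (Suc j) = {a @ u | a u. a \<in> S j \<and> u \<in> qsphere (v (Suc j))}" for j
    using block_product_snoc[of "{v0} # map qsphere (map v [1..<Suc j])"]
    by (simp add: S_def multisphere_def)
  have "determines (Q j) (S j) \<and> (\<exists>L. \<forall>a \<in> Q j \<union> S j. length a = L)" if "j \<le> r" for j
    using that
  proof (induction j)
    case 0
    have "Q 0 = {v0}" "S 0 = {v0}"
      by (auto simp: Q_def S_def multisphere_def block_product_def set_Cons_def)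
    then show ?case
      by (simp add: determines_def)
  next
    case (Suc j)
    then obtain L where IH: "determines (Q j) (S j)" "\<And>a. a \<in> Q j \<union> S j \<Longrightarrow> length a = L"
      by auto
    have j: "Suc j \<in> {1..r}"
      using Suc by simp
    have "length a = L + length (v (Suc j))" if "a \<in> Q (Suc j) \<union> S (Suc j)" for a
      using that IH(2) assms(2,3)[OF j] by (auto simp: Q_Suc S_Suc length_in_qsphere)
    then show ?case
      using determines_append_qsphere[OF IH assms(1-4)[OF j]] by (auto simp: Q_Suc S_Suc)
  qed
  then show ?thesis
    by (simp add: Q_def S_def)
qed

theorem lemma3p4:
  fixes n r :: nat and k :: "nat \<Rightarrow> nat"
    and v0 :: "quat list" and v w1 w2 :: "nat \<Rightarrow> quat list"
    and S Q :: "quat list set" and p :: qpoly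
  assumes "n = (\<Sum>i=0..r. k i)"
    and "\<And>i. i \<in> {1..r} \<Longrightarrow> k i \<ge> 1"
    and "length v0 = k 0"
    and "\<And>i. i \<in> {1..r} \<Longrightarrow> v i \<in> commuting_tuples (k i) - real_tuples (k i)"
    and "S = multisphere v0 (map v [1..<Suc r])"
    and "\<And>i. i \<in> {1..r} \<Longrightarrow> w1 i \<in> qsphere (v i)"
    and "\<And>i. i \<in> {1..r} \<Longrightarrow> w2 i \<in> qsphere (v i)"
    and "\<And>i. i \<in> {1..r} \<Longrightarrow> w1 i \<noteq> w2 i"
    and "Q = block_product ({v0} # map (\<lambda>i. {w1 i, w2 i}) [1..<Suc r])"
    and "p \<in> qpolys n"
    and "vanishes_on p Q"
  shows "vanishes_on p S"
  using determines_multisphere[OF assms(4,6,7,8)] assms(5,9,11)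
  by (simp add: determines_def)

end
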